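(* Let $p$ be an odd prime such that $(p,p)$ is hyperbolic, i.e. $1/p+1/p<1/2$. Then the regular map of type $(p,p)$ given by the generating triple $(X,Y,Z)$ of matrices described in the context is self-dual.
   Context: A regular map of type $(k,l)$ (vertex degree $k$, face length $l$) is identified with a group $G$ generated by three involutions $X,Y,Z$ such that $XY$, $YZ$, $ZX$ have orders exactly $2,k,l$ respectively. The map is self-dual if $G$ has an (involutory) automorphism fixing $Z$ and interchanging $X$ and $Y$. The maps considered have $G$ isomorphic to $PSL(2,q)$ or $PGL(2,q)$ with $q$ a power of the odd prime $p$. Matrices are regarded up to nonzero scalar multiples, i.e. as elements of $PGL(2,K)$ with $K$ an algebraic closure of $GF(p)$. For type $(p,p)$ the generating triple is, with $\alpha^2=-1$, $$X=-\alpha\begin{pmatrix}1&0\\2&-1\end{pmatrix},\quad Y=-\alpha\begin{pmatrix}1&-1\\0&-1\end{pmatrix},\quad Z=\alpha\begin{pmatrix}1&0\\0&-1\end{pmatrix}.$$ *)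

theory Defs
  imports
    "HOL-Analysis.Analysis"
    "HOL-Algebra.Generated_Groups"
    "HOL-Algebra.Multiplicative_Group"
    "HOL-Algebra.Algebraic_Closure_Type"
begin

text \<open>
  \<open>GF(p)\<close> is the prime subfield \<open>range of_int\<close> of a field of characteristic \<open>p\<close>.
\<close>

definition is_alg_closure_GF :: "'k::field itself \<Rightarrow> nat \<Rightarrow> bool" where
  "is_alg_closure_GF _ p \<longleftrightarrow>
     CHAR('k) = p \<and> algebraic_closure (ring_of_type_algebra :: 'k ring) (range of_int)"

definition GL2 :: "('k::field^2^2) monoid" where
  "GL2 = \<lparr>carrier = {A. invertible A}, monoid.mult = (**), one = mat 1\<rparr>"

definition scalars2 :: "('k::field^2^2) set" where
  "scalars2 = {mat c | c. c \<noteq> 0}"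

definition PGL2 :: "('k::field^2^2) set monoid" where
  "PGL2 = GL2 Mod scalars2"

definition proj_class :: "'k::field^2^2 \<Rightarrow> ('k^2^2) set" where
  "proj_class A = scalars2 #>\<^bsub>GL2\<^esub> A"

definition mat2 :: "'k::field \<Rightarrow> 'k \<Rightarrow> 'k \<Rightarrow> 'k \<Rightarrow> 'k^2^2" where
  "mat2 a b c d = vector [vector [a, b], vector [c, d]]"

text \<open>Type \<open>(k, l)\<close>: vertex degree \<open>k\<close>, face length \<open>l\<close>. The map is identified with its group and generating triple.\<close>

definition is_regular_map ::
    "('g, 'b) monoid_scheme \<Rightarrow> 'g \<Rightarrow> 'g \<Rightarrow> 'g \<Rightarrow> nat \<Rightarrow> nat \<Rightarrow> bool" where
  "is_regular_map G x y z k l \<longleftrightarrow>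
     group G \<and> {x, y, z} \<subseteq> carrier G \<and> generate G {x, y, z} = carrier G \<and>
     group.ord G x = 2 \<and> group.ord G y = 2 \<and> group.ord G z = 2 \<and>
     group.ord G (x \<otimes>\<^bsub>G\<^esub> y) = 2 \<and>
     group.ord G (y \<otimes>\<^bsub>G\<^esub> z) = k \<and>
     group.ord G (z \<otimes>\<^bsub>G\<^esub> x) = l"

definition is_self_dual :: "('g, 'b) monoid_scheme \<Rightarrow> 'g \<Rightarrow> 'g \<Rightarrow> 'g \<Rightarrow> bool" where
  "is_self_dual G x y z \<longleftrightarrow>
     (\<exists>\<phi> \<in> iso G G. (\<forall>g \<in> carrier G. \<phi> (\<phi> g) = g) \<and> \<phi> z = z \<and> \<phi> x = y \<and> \<phi> y = x)"

text \<open>The generating triple for type \<open>(p, p)\<close>; \<open>mat c ** A\<close> is the scalar multiple \<open>c A\<close>.\<close>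

definition X_pp :: "'k::field \<Rightarrow> ('k^2^2) set" where
  "X_pp \<alpha> = proj_class (mat (-\<alpha>) ** mat2 1 0 2 (-1))"

definition Y_pp :: "'k::field \<Rightarrow> ('k^2^2) set" where
  "Y_pp \<alpha> = proj_class (mat (-\<alpha>) ** mat2 1 (-1) 0 (-1))"

definition Z_pp :: "'k::field \<Rightarrow> ('k^2^2) set" where
  "Z_pp \<alpha> = proj_class (mat \<alpha> ** mat2 1 0 0 (-1))"

definition G_pp :: "'k::field \<Rightarrow> ('k^2^2) set monoid" where
  "G_pp \<alpha> = subgroup_generated PGL2 {X_pp \<alpha>, Y_pp \<alpha>, Z_pp \<alpha>}"

end

theory Submission
  imports Defs
begin

text \<open>
  The matrix \<open>M = (0 1; 2 0)\<close> satisfies \<open>M\<^sup>2 = 2 I\<close>, \<open>M X = - Y M\<close> and \<open>M Z = - Z M\<close>, so conjugation by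
  its class is an involutory automorphism of \<open>PGL(2, K)\<close> that interchanges \<open>X\<close> and \<open>Y\<close> and fixes \<open>Z\<close>;
  it therefore restricts to the group they generate. The orders are read off from the matrices:
  \<open>X\<close>, \<open>Y\<close>, \<open>Z\<close> and \<open>X Y\<close> are traceless, so their squares are scalar by Cayley--Hamilton,
  while \<open>Y Z\<close> and \<open>Z X\<close> are nontrivial transvections and hence have order \<open>p\<close>.
\<close>

section \<open>Entrywise computation with two-by-two matrices\<close>

lemma mat2_nth [simp]:
  "mat2 a b c d $ 1 $ 1 = a"
  "mat2 a b c d $ 1 $ 2 = b"
  "mat2 a b c d $ 2 $ 1 = c"
  "mat2 a b c d $ 2 $ 2 = d"
  by (simp_all add: mat2_def)

lemma mat2_mult:
  "mat2 a b c d ** mat2 a' b' c' d' =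
     mat2 (a * a' + b * c') (a * b' + b * d') (c * a' + d * c') (c * b' + d * d')"
  by (simp add: vec_eq_iff forall_2 matrix_matrix_mult_def sum_2)

lemma mat_conv_mat2: "(mat c :: 'k::field^2^2) = mat2 c 0 0 c"
  by (simp add: vec_eq_iff forall_2 mat_def)

lemma mat2_eq_iff: "mat2 a b c d = mat2 a' b' c' d' \<longleftrightarrow> a = a' \<and> b = b' \<and> c = c' \<and> d = d'"
  by (auto simp: vec_eq_iff forall_2)

lemma invertible_mat2: "invertible (mat2 a b c d) \<longleftrightarrow> a * d - b * c \<noteq> (0 :: 'k::field)"
  by (simp add: invertible_det_nz det_2)

lemma mat_mult_commute:
  fixes A :: "'k::field^2^2"
  shows "mat c ** A = A ** mat c"
  by (simp add: vec_eq_iff forall_2 matrix_matrix_mult_def sum_2 mat_def)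

lemma carrier_GL2 [simp]: "A \<in> carrier GL2 \<longleftrightarrow> invertible A"
  and mult_GL2 [simp]: "A \<otimes>\<^bsub>GL2\<^esub> B = A ** B"
  and one_GL2 [simp]: "\<one>\<^bsub>GL2\<^esub> = mat 1"
  by (simp_all add: GL2_def)

section \<open>The general linear group and its scalar subgroup\<close>

lemma group_GL2: "group (GL2 :: ('k::field^2^2) monoid)"
proof (rule groupI)
  fix A :: "'k^2^2"
  assume "A \<in> carrier GL2"
  then obtain B where "A ** B = mat 1" "B ** A = mat 1"
    by (auto simp: invertible_def)
  then show "\<exists>B\<in>carrier GL2. B \<otimes>\<^bsub>GL2\<^esub> A = \<one>\<^bsub>GL2\<^esub>"
    by (intro bexI[of _ B]) (auto simp: invertible_def)
next
  show "\<one>\<^bsub>GL2\<^esub> \<in> carrier (GL2 :: ('k^2^2) monoid)"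
    by (simp add: mat_conv_mat2 invertible_mat2)
qed (simp_all add: invertible_mult matrix_mul_assoc)

interpretation GL2: group "GL2 :: ('k::field^2^2) monoid"
  by (rule group_GL2)

text \<open>Scalar matrices are central, so left and right cosets coincide; this makes the quotient
  \<open>PGL2\<close> a group.\<close>

lemma normal_scalars2: "(scalars2 :: ('k::field^2^2) set) \<lhd> GL2"
proof -
  have scalar_mult: "mat c ** mat d = (mat (c * d) :: 'k^2^2)" for c d
    by (simp add: mat_conv_mat2 mat2_mult)
  have scalar_invertible: "invertible (mat c :: 'k^2^2)" if "c \<noteq> 0" for c
    using that by (simp add: mat_conv_mat2 invertible_mat2)
  have scalar_inv: "inv\<^bsub>GL2\<^esub> (mat c) = (mat (inverse c) :: 'k^2^2)" if "c \<noteq> 0" for c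
    using that by (intro GL2.inv_equality) (auto simp: scalar_mult scalar_invertible)
  have "subgroup (scalars2 :: ('k^2^2) set) GL2"
  proof (rule GL2.subgroupI)
    show "scalars2 \<subseteq> carrier (GL2 :: ('k^2^2) monoid)"
      by (auto simp: scalars2_def scalar_invertible)
    show "(scalars2 :: ('k^2^2) set) \<noteq> {}"
      by (auto simp: scalars2_def intro: exI[of _ 1])
    show "inv\<^bsub>GL2\<^esub> A \<in> scalars2" if "A \<in> scalars2" for A :: "'k^2^2"
      using that scalar_inv nonzero_imp_inverse_nonzero unfolding scalars2_def by blast
    show "A \<otimes>\<^bsub>GL2\<^esub> B \<in> scalars2" if "A \<in> scalars2" "B \<in> scalars2" for A B :: "'k^2^2"
    proof -
      obtain c d where "A = mat c" "B = mat d" "c * d \<noteq> 0"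
        using \<open>A \<in> scalars2\<close> \<open>B \<in> scalars2\<close> by (auto simp: scalars2_def)
      then show ?thesis
        using scalar_mult by (auto simp: scalars2_def simp del: mult_eq_0_iff)
    qed
  qed
  then show ?thesis
    by (rule GL2.normalI) (auto simp: r_coset_def l_coset_def scalars2_def mat_mult_commute)
qed

interpretation scalars2: normal "scalars2 :: ('k::field^2^2) set" GL2
  by (rule normal_scalars2)

section \<open>Computing with representatives in the projective group\<close>

lemma group_PGL2: "group (PGL2 :: ('k::field^2^2) set monoid)"
  unfolding PGL2_def by (rule scalars2.factorgroup_is_group)

lemma proj_class_in_PGL2: "invertible A \<Longrightarrow> proj_class A \<in> carrier PGL2"
  by (auto simp: PGL2_def proj_class_def FactGroup_def RCOSETS_def)

lemma proj_class_mult: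
  assumes "invertible A" "invertible B"
  shows "proj_class A \<otimes>\<^bsub>PGL2\<^esub> proj_class B = proj_class (A ** B)"
  using assms scalars2.rcos_sum[of A B] by (simp add: PGL2_def proj_class_def FactGroup_def)

lemma proj_class_eq_one_iff:
  assumes "invertible A"
  shows "proj_class A = \<one>\<^bsub>PGL2\<^esub> \<longleftrightarrow> A \<in> scalars2"
  using assms GL2.coset_join1[of scalars2 A] GL2.coset_join2[of A scalars2] scalars2.subgroup_axioms
  by (auto simp: PGL2_def proj_class_def FactGroup_def)

text \<open>Scalars have trivial class. This removes the factors \<alpha> and -\<alpha> from the
  generating triple and the signs from the relations for \<open>?M\<close>.\<close>

lemma proj_class_scalar_mult:
  fixes A :: "'k::field^2^2"
  assumes "invertible A" "c \<noteq> 0"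
  shows "proj_class (mat c ** A) = proj_class A"
proof -
  interpret PGL2: group "PGL2 :: ('k^2^2) set monoid" by (rule group_PGL2)
  have c: "invertible (mat c :: 'k^2^2)"
    using assms(2) by (simp add: mat_conv_mat2 invertible_mat2)
  have "proj_class (mat c ** A) = proj_class (mat c) \<otimes>\<^bsub>PGL2\<^esub> proj_class A"
    using assms(1) c by (simp add: proj_class_mult)
  also have "proj_class (mat c :: 'k^2^2) = \<one>\<^bsub>PGL2\<^esub>"
    using c assms(2) by (auto simp: proj_class_eq_one_iff scalars2_def)
  finally show ?thesis
    using assms(1) by (simp add: proj_class_in_PGL2)
qed

section \<open>Orders and automorphisms in generated subgroups\<close>

lemma (in group) ord_eq_primeI:
  assumes "x \<in> carrier G" "Factorial_Ring.prime (n :: nat)" "x [^] n = \<one>" "x \<noteq> \<one>"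
  shows "ord x = n"
proof -
  have "ord x dvd n"
    using assms(1,3) by (simp add: pow_eq_id)
  moreover have "ord x \<noteq> 1"
    using assms(1,4) ord_eq_1 by blast
  ultimately show ?thesis
    using assms(2) by (metis prime_nat_iff)
qed

text \<open>Powers and the identity are those of the ambient group, so the same exponents kill
  \<open>x\<close> in both.\<close>

lemma (in group) ord_subgroup_generated:
  assumes "x \<in> carrier (subgroup_generated G S)"
  shows "group.ord (subgroup_generated G S) x = ord x"
proof -
  interpret S: group "subgroup_generated G S" by simp
  have "x \<in> carrier G"
    using assms carrier_subgroup_generated_subset by blast
  then show ?thesis
    using assms S.pow_eq_id[of x] pow_eq_id[of x]
    by (simp add: S.ord_unique pow_subgroup_generated)
qed

text \<open>\<open>subgroup_generated\<close> first intersects its generators with the carrier.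
  Since \<open>S\<close> lies in both carriers, generating from \<open>S\<close> a second time,
  inside the subgroup, changes nothing.\<close>

lemma (in group) generate_subgroup_generated:
  assumes "S \<subseteq> carrier G"
  shows "generate (subgroup_generated G S) S = carrier (subgroup_generated G S)"
  using subgroup_generated2[of S] subgroup_generated_subset_carrier_subset[OF assms]
  by (metis carrier_subgroup_generated inf.absorb2)

text \<open>Conjugation by \<open>m\<close> is an involutory automorphism of the whole group, and
  \<open>m\<close> itself may lie outside the subgroup. The relations are stated without inverses so
  that they can be checked by multiplying matrices.\<close>

lemma (in group) is_self_dual_subgroup_generatedI:
  assumes m: "m \<in> carrier G" "m \<otimes> m = \<one>"
    and xyz: "x \<in> carrier G" "y \<in> carrier G" "z \<in> carrier G"
    and mx: "m \<otimes> x = y \<otimes> m" and mz: "m \<otimes> z = z \<otimes> m"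
  shows "is_self_dual (subgroup_generated G {x, y, z}) x y z"
proof -
  define \<phi> where "\<phi> g = m \<otimes> g \<otimes> m" for g
  have cancel: "a \<otimes> m \<otimes> m = a" "m \<otimes> (m \<otimes> a) = a" if "a \<in> carrier G" for a
    using that m by (simp_all add: m_assoc flip: m_assoc[of m m a])
  have invol: "\<phi> (\<phi> g) = g" if "g \<in> carrier G" for g
    using that m cancel by (simp add: \<phi>_def m_assoc)
  have "\<phi> \<in> hom G G"
    using m cancel by (auto simp: hom_def \<phi>_def m_assoc)
  moreover have "bij_betw \<phi> (carrier G) (carrier G)"
    by (rule bij_betw_byWitness[where f' = \<phi>]) (use invol m in \<open>auto simp: \<phi>_def\<close>)
  ultimately have iso: "\<phi> \<in> iso G G"
    by (simp add: iso_def)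
  have \<phi>x: "\<phi> x = y" and \<phi>z: "\<phi> z = z"
    using xyz m cancel by (simp_all add: \<phi>_def mx mz)
  then have \<phi>y: "\<phi> y = x"
    using invol xyz by blast
  \<comment> \<open>The automorphism permutes the generating set, hence restricts to the
    subgroup.\<close>
  have "\<phi> \<in> iso (subgroup_generated G {x, y, z}) (subgroup_generated G {x, y, z})"
    using iso xyz \<phi>x \<phi>y \<phi>z \<open>\<phi> \<in> hom G G\<close>
    by (intro group_hom.iso_between_subgroups)
      (auto simp: group_hom_def group_hom_axioms_def is_group)
  then show ?thesis
    using invol carrier_subgroup_generated_subset \<phi>x \<phi>y \<phi>z
    unfolding is_self_dual_def by blast
qed

section \<open>Orders of unipotent and traceless classes\<close>

lemma proj_class_unipotent_pow:
  fixes s t :: "'k::field"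
  assumes "s * t = 0"
  shows "proj_class (mat2 1 s t 1) [^]\<^bsub>PGL2\<^esub> n =
    proj_class (mat2 1 (of_nat n * s) (of_nat n * t) 1)"
proof -
  interpret PGL2: group "PGL2 :: ('k^2^2) set monoid" by (rule group_PGL2)
  have "proj_class (mat2 1 0 0 (1 :: 'k)) = \<one>\<^bsub>PGL2\<^esub>"
    by (subst proj_class_eq_one_iff) (auto simp: invertible_mat2 scalars2_def mat_conv_mat2)
  \<comment> \<open>The diagonal entries of the next power are 1 + n s t = 1, so off-diagonal
    entries simply add. The condition s t = 0 covers upper and lower triangular matrices at
    once.\<close>
  with assms show ?thesis
    by (induction n)
      (auto simp: proj_class_mult invertible_mat2 mat2_mult algebra_simps)
qed

text \<open>The power with exponent \<open>CHAR('k)\<close> has zero off-diagonal entries, and a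
  nonzero off-diagonal entry keeps the matrix itself from being scalar; primality of the exponent
  then fixes the order.\<close>

lemma ord_proj_class_unipotent:
  fixes s t :: "'k::field"
  assumes "Factorial_Ring.prime CHAR('k)" "s * t = 0" "s \<noteq> 0 \<or> t \<noteq> 0"
  shows "group.ord PGL2 (proj_class (mat2 1 s t 1)) = CHAR('k)"
proof -
  interpret PGL2: group "PGL2 :: ('k^2^2) set monoid" by (rule group_PGL2)
  have inv: "invertible (mat2 1 s t 1)" "invertible (mat2 1 0 0 (1 :: 'k))"
    by (simp_all only: invertible_mat2 assms(2)) simp_all
  show ?thesis
    using assms inv
    by (intro PGL2.ord_eq_primeI)
      (auto simp: proj_class_in_PGL2 proj_class_unipotent_pow proj_class_eq_one_iff
        scalars2_def mat_conv_mat2 mat2_eq_iff)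
qed

lemma ord_proj_class_traceless:
  fixes a b c :: "'k::field"
  assumes "invertible (mat2 a b c (- a))" "(2 :: 'k) \<noteq> 0"
  shows "group.ord PGL2 (proj_class (mat2 a b c (- a))) = 2"
proof -
  interpret PGL2: group "PGL2 :: ('k^2^2) set monoid" by (rule group_PGL2)
  have "mat2 a b c (- a) ** mat2 a b c (- a) = mat (a * a + b * c)"
    by (simp add: mat2_mult mat_conv_mat2 algebra_simps)
  \<comment> \<open>The scalar in the square is minus the determinant, so invertibility makes it
    nonzero.\<close>
  moreover have "a * (- a) - b * c = - (a * a + b * c)"
    by simp
  then have "a * a + b * c \<noteq> 0"
    using assms(1) by (simp only: invertible_mat2 neg_equal_0_iff_equal not_False_eq_True)
  ultimately have "mat2 a b c (- a) ** mat2 a b c (- a) \<in> scalars2"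
    by (auto simp: scalars2_def)
  then have "proj_class (mat2 a b c (- a)) [^]\<^bsub>PGL2\<^esub> (2 :: nat) = \<one>\<^bsub>PGL2\<^esub>"
    using assms(1)
    by (simp add: numeral_2_eq_2 proj_class_in_PGL2 proj_class_mult proj_class_eq_one_iff
        invertible_mult)
  \<comment> \<open>A scalar matrix of this shape has a = -a, which forces a = 0 when 2 is nonzero;
    but zero is not an admissible scalar.\<close>
  moreover have "mat2 a b c (- a) \<notin> scalars2"
    using assms by (auto simp: scalars2_def mat_conv_mat2 mat2_eq_iff eq_neg_iff_add_eq_0
        simp flip: mult_2)
  ultimately show ?thesis
    using assms(1)
    by (intro PGL2.ord_eq_primeI) (auto simp: proj_class_in_PGL2 proj_class_eq_one_iff)
qed

section \<open>Orders and duality for the explicit triple\<close>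

theorem proposition3p1:
  fixes p :: nat and \<alpha> :: "'k::field"
  assumes "Factorial_Ring.prime p" and "odd p"
    and hyperbolic: "1 / real p + 1 / real p < 1 / 2"
    and K: "is_alg_closure_GF TYPE('k) p"
    and alpha: "\<alpha>\<^sup>2 = -1"
  shows "is_regular_map (G_pp \<alpha>) (X_pp \<alpha>) (Y_pp \<alpha>) (Z_pp \<alpha>) p p \<and>
    is_self_dual (G_pp \<alpha>) (X_pp \<alpha>) (Y_pp \<alpha>) (Z_pp \<alpha>)"
proof -
  interpret PGL2: group "PGL2 :: ('k^2^2) set monoid" by (rule group_PGL2)
  have char: "CHAR('k) = p"
    using K by (simp add: is_alg_closure_GF_def)
  then have two: "(2 :: 'k) \<noteq> 0"
    using assms(1,2) of_nat_eq_0_iff_char_dvd[where n = 2 and 'a = 'k]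
    by (metis of_nat_numeral primes_dvd_imp_eq two_is_prime_nat even_numeral)
  have nz: "\<alpha> \<noteq> 0"
    using alpha by auto
  \<comment> \<open>An antidiagonal \<open>?M\<close> swaps the two eigenlines of \<open>?Z\<close>,
    so it commutes with \<open>?Z\<close> up to sign. With upper entry 1, proportionality of
    \<open>?M ** ?X\<close> and \<open>?Y ** ?M\<close> forces the lower entry 2.\<close>
  let ?X = "mat2 1 0 2 (- 1) :: 'k^2^2" and ?Y = "mat2 1 (- 1) 0 (- 1) :: 'k^2^2"
    and ?Z = "mat2 1 0 0 (- 1) :: 'k^2^2" and ?M = "mat2 0 1 2 0 :: 'k^2^2"
  have inv: "invertible ?X" "invertible ?Y" "invertible ?Z" "invertible ?M"
    using two by (simp_all add: invertible_mat2)
  have X: "X_pp \<alpha> = proj_class ?X" and Y: "Y_pp \<alpha> = proj_class ?Y" and Z: "Z_pp \<alpha> = proj_class ?Z"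
    using inv nz by (simp_all add: X_pp_def Y_pp_def Z_pp_def proj_class_scalar_mult)
  let ?S = "{X_pp \<alpha>, Y_pp \<alpha>, Z_pp \<alpha>}"
  have S: "?S \<subseteq> carrier PGL2"
    using inv by (simp add: X Y Z proj_class_in_PGL2)
  have S': "?S \<subseteq> carrier (G_pp \<alpha>)"
    unfolding G_pp_def by (rule PGL2.subgroup_generated_subset_carrier_subset[OF S])
  interpret H: group "G_pp \<alpha>"
    by (simp add: G_pp_def)
  have ord_H: "H.ord g = PGL2.ord g" if "g \<in> carrier (G_pp \<alpha>)" for g
    using that by (simp add: G_pp_def PGL2.ord_subgroup_generated)
  have mult_H: "g \<otimes>\<^bsub>G_pp \<alpha>\<^esub> h = g \<otimes>\<^bsub>PGL2\<^esub> h" for g h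
    by (simp add: G_pp_def)
  have "PGL2.ord (X_pp \<alpha>) = 2" "PGL2.ord (Y_pp \<alpha>) = 2" "PGL2.ord (Z_pp \<alpha>) = 2"
    using inv two by (simp_all add: X Y Z ord_proj_class_traceless)
  \<comment> \<open>The product \<open>?X ** ?Y\<close> is \<open>mat2 1 (-1) 2 (-1)\<close>,
    traceless of determinant 1.\<close>
  moreover have "PGL2.ord (X_pp \<alpha> \<otimes>\<^bsub>PGL2\<^esub> Y_pp \<alpha>) = 2"
    using inv two ord_proj_class_traceless[of 1 "- 1" "2 :: 'k"]
    by (simp add: X Y proj_class_mult mat2_mult invertible_mat2)
  moreover have "PGL2.ord (Y_pp \<alpha> \<otimes>\<^bsub>PGL2\<^esub> Z_pp \<alpha>) = p"
    using inv assms(1) char ord_proj_class_unipotent[of 1 "0 :: 'k"]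
    by (simp add: Y Z proj_class_mult mat2_mult)
  \<comment> \<open>Here the transvection is lower triangular with entry -2, nontrivial because the
    characteristic is odd.\<close>
  moreover have "PGL2.ord (Z_pp \<alpha> \<otimes>\<^bsub>PGL2\<^esub> X_pp \<alpha>) = p"
    using inv assms(1) char two ord_proj_class_unipotent[of 0 "- 2 :: 'k"]
    by (simp add: X Z proj_class_mult mat2_mult)
  moreover have "generate (G_pp \<alpha>) ?S = carrier (G_pp \<alpha>)"
    using PGL2.generate_subgroup_generated[OF S] by (simp add: G_pp_def)
  ultimately have "is_regular_map (G_pp \<alpha>) (X_pp \<alpha>) (Y_pp \<alpha>) (Z_pp \<alpha>) p p"
    using S' by (simp add: is_regular_map_def ord_H H.is_group flip: mult_H)
  moreover have "is_self_dual (G_pp \<alpha>) (X_pp \<alpha>) (Y_pp \<alpha>) (Z_pp \<alpha>)"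
    unfolding G_pp_def
  proof (rule PGL2.is_self_dual_subgroup_generatedI)
    show "proj_class ?M \<in> carrier PGL2"
      using inv by (simp add: proj_class_in_PGL2)
    have "?M ** ?M = mat 2"
      by (simp add: mat2_mult mat_conv_mat2)
    then have "?M ** ?M \<in> scalars2"
      using two by (auto simp: scalars2_def)
    then show "proj_class ?M \<otimes>\<^bsub>PGL2\<^esub> proj_class ?M = \<one>\<^bsub>PGL2\<^esub>"
      using inv by (simp add: proj_class_mult proj_class_eq_one_iff invertible_mult)
    have "?M ** ?X = mat (- 1) ** (?Y ** ?M)"
      by (simp add: mat2_mult mat_conv_mat2)
    then show "proj_class ?M \<otimes>\<^bsub>PGL2\<^esub> X_pp \<alpha> = Y_pp \<alpha> \<otimes>\<^bsub>PGL2\<^esub> proj_class ?M"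
      using inv by (simp add: X Y proj_class_mult proj_class_scalar_mult invertible_mult)
    have "?M ** ?Z = mat (- 1) ** (?Z ** ?M)"
      by (simp add: mat2_mult mat_conv_mat2)
    then show "proj_class ?M \<otimes>\<^bsub>PGL2\<^esub> Z_pp \<alpha> = Z_pp \<alpha> \<otimes>\<^bsub>PGL2\<^esub> proj_class ?M"
      using inv by (simp add: Z proj_class_mult proj_class_scalar_mult invertible_mult)
  qed (use S in auto)
  ultimately show ?thesis ..
qed

end
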